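(* Let $L\colon\mathbb R^n\times\mathbb R^n\to\mathbb R_+$ and $\varphi\colon\mathbb R^n\to\mathbb R_+\cup\{+\infty\}$ satisfy the standing assumptions listed in the context, and let $V$ be the value function. If $L$ is locally bounded, then $V$ is locally Lipschitz on $\mathbb R_+^\star\times\mathbb R^n$.
   Context: Notation: $\mathbb R_+=[0,+\infty)$, $\mathbb R_+^\star=(0,+\infty)$. Standing assumptions: $L\colon\mathbb R^n\times\mathbb R^n\to\mathbb R_+$ is lower semicontinuous and $L(x,\cdot)$ is convex for every $x$; there is a convex function $\Theta\colon\mathbb R^n\to\mathbb R_+$ with $\lim_{|u|\to\infty}\Theta(u)/|u|=+\infty$ and $L(x,u)\ge\Theta(u)$ for all $(x,u)$; $\varphi\colon\mathbb R^n\to\mathbb R_+\cup\{+\infty\}$ is lower semicontinuous and not identically $+\infty$. Value function: for $(t,x)\in\mathbb R_+\times\mathbb R^n$, $$V(t,x)=\inf\Big\{\int_0^t L(y(s),y'(s))\,ds+\varphi(y(t)) : y\in W^{1,1}(0,t;\mathbb R^n),\ y(0)=x\Big\}.$$ *)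

theory Defs
  imports "HOL-Analysis.Analysis"
begin

definition lower_semicontinuous ::
    "('a::topological_space \<Rightarrow> 'b::linorder_topology) \<Rightarrow> bool" where
  "lower_semicontinuous f \<longleftrightarrow>
     (\<forall>x. \<forall>a. a < f x \<longrightarrow> (\<forall>\<^sub>F z in nhds x. a < f z))"

definition locally_bounded ::
    "('a::metric_space \<Rightarrow> 'b::real_normed_vector) \<Rightarrow> bool" where
  "locally_bounded f \<longleftrightarrow> (\<forall>x. \<exists>e>0. bounded (f ` ball x e))"

definition locally_lipschitz_on ::
    "'a::metric_space set \<Rightarrow> ('a \<Rightarrow> 'b::metric_space) \<Rightarrow> bool" where
  "locally_lipschitz_on S f \<longleftrightarrow>
     (\<forall>x\<in>S. \<exists>e>0. \<exists>C. C-lipschitz_on (ball x e \<inter> S) f)"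

text \<open>The test functions are those of class \<open>C\<^sup>1\<close> with compact support in the open interval, as in
  Brezis' definition of the Sobolev spaces \<open>W\<^sup>1\<^sup>,\<^sup>p\<close> in dimension one.\<close>

definition test_function :: "real \<Rightarrow> real \<Rightarrow> (real \<Rightarrow> real) \<Rightarrow> bool" where
  "test_function a b \<psi> \<longleftrightarrow>
     \<psi> C1_differentiable_on UNIV \<and>
     compact (closure {s. \<psi> s \<noteq> 0}) \<and> closure {s. \<psi> s \<noteq> 0} \<subseteq> {a<..<b}"

text \<open>\<open>has_W11_derivative a b y v\<close>: the function \<open>y\<close> belongs to \<open>W\<^sup>1\<^sup>,\<^sup>1(a,b)\<close> and \<open>v\<close> is a (Borel)
  representative of its weak derivative.\<close>

definition has_W11_derivative ::
    "real \<Rightarrow> real \<Rightarrow> (real \<Rightarrow> 'a::euclidean_space) \<Rightarrow> (real \<Rightarrow> 'a) \<Rightarrow> bool" where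
  "has_W11_derivative a b y v \<longleftrightarrow>
     set_integrable lborel {a<..<b} y \<and>
     set_integrable lborel {a<..<b} v \<and>
     (\<forall>\<psi>. test_function a b \<psi> \<longrightarrow>
        (LINT s:{a<..<b}|lborel. deriv \<psi> s *\<^sub>R y s) =
        - (LINT s:{a<..<b}|lborel. \<psi> s *\<^sub>R v s))"

text \<open>The endpoint values \<open>y 0\<close> and \<open>y t\<close> refer to the continuous representative of \<open>y\<close> on the closed
  interval. The integral does not depend on the representative \<open>v\<close> of the weak derivative, so that
  letting \<open>v\<close> range over all of them does not change the infimum. Only \<open>t \<ge> 0\<close> is meaningful.\<close>

definition value_function ::
    "('a::euclidean_space \<Rightarrow> 'a \<Rightarrow> real) \<Rightarrow> ('a \<Rightarrow> ennreal) \<Rightarrow> real \<Rightarrow> 'a \<Rightarrow> ennreal" where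
  "value_function L \<phi> t x =
     Inf {(\<integral>\<^sup>+ s \<in> {0..t}. ennreal (L (y s) (v s)) \<partial>lborel) + \<phi> (y t) | y v.
            continuous_on {0..t} y \<and> has_W11_derivative 0 t y v \<and> y 0 = x}"

end

theory Submission
  imports Defs
begin

text \<open>Admissible trajectories are the primitives of integrable velocities, so a path may be cut, shifted
  in time and concatenated freely. Three modifications of a nearly optimal path for \<open>(t, x)\<close> suffice,
  each at a cost \<open>M * h\<close>, where \<open>M\<close> is a bound of \<open>L\<close> on a fixed compact set: waiting at \<open>x\<close> for a time \<open>h\<close>;
  moving first from \<open>x'\<close> to \<open>x\<close> at unit speed; and saving a time \<open>h\<close>. For the last one, superlinear growth
  bounds the displacement of a path by its duration plus its cost, hence by the pigeonhole principle
  some piece of duration \<open>2 * h\<close> has displacement of order \<open>h\<close>, and it can be replaced by a straight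
  segment of duration \<open>h\<close> and bounded speed. Neither the existence of minimizers nor a change of
  variables along the path is needed.\<close>

subsection \<open>Paths given by their velocity\<close>

lemma borel_measurable_lower_semicontinuous:
  fixes f :: "'a::topological_space \<Rightarrow> real"
  assumes "lower_semicontinuous f"
  shows "f \<in> borel_measurable borel"
proof (rule borel_measurableI_greater)
  fix a
  have "open {x. a < f x}"
    unfolding open_subopen[of "{x. a < f x}"]
    using assms by (fastforce simp: lower_semicontinuous_def eventually_nhds)
  then show "{x \<in> space borel. a < f x} \<in> sets borel"
    by simp
qed

lemma set_nn_integral_Ioc_shift:
  fixes f :: "real \<Rightarrow> ennreal"
  assumes [measurable]: "f \<in> borel_measurable borel" and "0 \<le> a" "0 \<le> T"
  shows "(\<integral>\<^sup>+ s\<in>{0<..a + T}. f s \<partial>lborel) =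
    (\<integral>\<^sup>+ s\<in>{0<..a}. f s \<partial>lborel) + (\<integral>\<^sup>+ s\<in>{0<..T}. f (a + s) \<partial>lborel)"
proof -
  have "(\<integral>\<^sup>+ s\<in>{0<..a + T}. f s \<partial>lborel) = (\<integral>\<^sup>+ s\<in>{0<..a} \<union> {a<..a + T}. f s \<partial>lborel)"
    using assms by (intro arg_cong[where f="\<lambda>S. \<integral>\<^sup>+ s\<in>S. f s \<partial>lborel"]) auto
  also have "\<dots> = (\<integral>\<^sup>+ s\<in>{0<..a}. f s \<partial>lborel) + (\<integral>\<^sup>+ s\<in>{a<..a + T}. f s \<partial>lborel)"
    by (intro nn_integral_disjoint_pair) auto
  also have "(\<integral>\<^sup>+ s\<in>{a<..a + T}. f s \<partial>lborel) =
      (\<integral>\<^sup>+ s. f (a + s) * indicator {a<..a + T} (a + s) \<partial>lborel)"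
    by (subst nn_integral_real_affine[where c=1 and t=a]) auto
  also have "\<dots> = (\<integral>\<^sup>+ s\<in>{0<..T}. f (a + s) \<partial>lborel)"
    by (intro nn_integral_cong) (auto simp: indicator_def)
  finally show ?thesis .
qed

lemma set_integral_Ioc_shift:
  fixes v :: "real \<Rightarrow> 'a::euclidean_space"
  assumes v: "integrable lborel v" and "0 \<le> a" "0 \<le> T"
  shows "(LINT s:{0<..a + T}|lborel. v s) =
    (LINT s:{0<..a}|lborel. v s) + (LINT s:{0<..T}|lborel. v (a + s))"
proof -
  have *: "set_integrable lborel S v" if "S \<in> sets lborel" for S
    unfolding set_integrable_def using v that by (rule integrable_mult_indicator[rotated])
  have "(LINT s:{0<..a + T}|lborel. v s) = (LINT s:{0<..a} \<union> {a<..a + T}|lborel. v s)"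
    using assms by (intro arg_cong[where f="\<lambda>S. LINT s:S|lborel. v s"]) auto
  also have "\<dots> = (LINT s:{0<..a}|lborel. v s) + (LINT s:{a<..a + T}|lborel. v s)"
    by (intro set_integral_Un *) auto
  also have "(LINT s:{a<..a + T}|lborel. v s) =
      (LINT s|lborel. indicator {a<..a + T} (a + s) *\<^sub>R v (a + s))"
    unfolding set_lebesgue_integral_def
    by (subst lborel_integral_real_affine[where c=1 and t=a]) auto
  also have "\<dots> = (LINT s:{0<..T}|lborel. v (a + s))"
    unfolding set_lebesgue_integral_def
    by (intro Bochner_Integration.integral_cong) (auto simp: indicator_def)
  finally show ?thesis .
qed

text \<open>Half-open intervals make the splitting of a path at an intermediate time exact.\<close>

definition primitive_from :: "'a::euclidean_space \<Rightarrow> (real \<Rightarrow> 'a) \<Rightarrow> real \<Rightarrow> 'a" where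
  "primitive_from x v s = x + (LINT r:{0<..s}|lborel. v r)"

definition running_cost ::
    "('a::euclidean_space \<Rightarrow> 'a \<Rightarrow> real) \<Rightarrow> 'a \<Rightarrow> (real \<Rightarrow> 'a) \<Rightarrow> real \<Rightarrow> ennreal" where
  "running_cost L x v T = (\<integral>\<^sup>+ s\<in>{0<..T}. ennreal (L (primitive_from x v s) (v s)) \<partial>lborel)"

text \<open>Here \<open>c\<close> is the exact cost of one path, neither an infimum nor an upper
  bound, so that costs add up exactly under concatenation and splitting. Hiding the velocity lets
  later arguments work with endpoints, durations and costs alone.\<close>

definition reach ::
    "('a::euclidean_space \<Rightarrow> 'a \<Rightarrow> real) \<Rightarrow> 'a \<Rightarrow> real \<Rightarrow> 'a \<Rightarrow> ennreal \<Rightarrow> bool" where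
  "reach L x T z c \<longleftrightarrow>
    (\<exists>v. integrable lborel v \<and> z = primitive_from x v T \<and> c = running_cost L x v T)"

lemma primitive_from_0 [simp]: "primitive_from x v 0 = x"
  by (simp add: primitive_from_def set_lebesgue_integral_def)

lemma primitive_from_cong:
  assumes "\<And>r. 0 < r \<Longrightarrow> r \<le> s \<Longrightarrow> v r = w r"
  shows "primitive_from x v s = primitive_from x w s"
  unfolding primitive_from_def
  by (intro arg_cong2[where f="(+)"] refl set_lebesgue_integral_cong) (auto simp: assms)

lemma running_cost_cong:
  assumes "\<And>r. 0 < r \<Longrightarrow> r \<le> T \<Longrightarrow> v r = w r"
  shows "running_cost L x v T = running_cost L x w T"
proof -
  have "primitive_from x v s = primitive_from x w s" if "s \<le> T" for s
    using assms that by (intro primitive_from_cong) auto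
  then show ?thesis
    unfolding running_cost_def using assms by (intro nn_integral_cong) (auto simp: indicator_def)
qed

lemma borel_measurable_primitive_from [measurable]:
  assumes [measurable]: "v \<in> borel_measurable borel"
  shows "primitive_from x v \<in> borel_measurable borel"
proof -
  \<comment> \<open>With the moving domain written as a condition, the integrand is jointly
    measurable in the time and the integration variable, and measurability of parameter integrals
    applies.\<close>
  have "primitive_from x v = (\<lambda>s. x + (LINT r|lborel. (if 0 < r \<and> r \<le> s then v r else 0)))"
    by (auto simp: primitive_from_def set_lebesgue_integral_def indicator_def fun_eq_iff
        intro!: Bochner_Integration.integral_cong)
  also have "\<dots> \<in> borel_measurable borel"
    by measurable
  finally show ?thesis .
qed

lemma primitive_from_shift:
  assumes "integrable lborel v" "0 \<le> a" "0 \<le> s"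
  shows "primitive_from x v (a + s) = primitive_from (primitive_from x v a) (\<lambda>r. v (a + r)) s"
  by (simp add: primitive_from_def set_integral_Ioc_shift[OF assms] add.assoc)

lemma continuous_on_primitive_from:
  assumes "integrable lborel v"
  shows "continuous_on {0..T} (primitive_from x v)"
proof -
  have *: "set_integrable lborel S v" if "S \<in> sets lborel" for S
    unfolding set_integrable_def using assms that by (rule integrable_mult_indicator[rotated])
  have "primitive_from x v s = x + integral {0..s} v" if "s \<in> {0..T}" for s
  proof -
    \<comment> \<open>The endpoint \<open>0\<close> is a null set, so the half-open interval may be
      closed and continuity of indefinite integrals becomes available.\<close>
    have "AE r in lborel. r \<noteq> (0::real)"
      by (rule AE_lborel_singleton)
    then have "(LINT r:{0<..s}|lborel. v r) = (LINT r:{0..s}|lborel. v r)"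
      unfolding set_lebesgue_integral_def using assms
      by (intro integral_cong_AE) (auto simp: indicator_def elim!: eventually_mono)
    then show ?thesis
      using *[of "{0..s}"] by (simp add: primitive_from_def set_borel_integral_eq_integral)
  qed
  moreover have "continuous_on {0..T} (\<lambda>s. x + integral {0..s} v)"
    using set_borel_integral_eq_integral(1)[OF *[of "{0..T}"]]
    by (intro continuous_intros indefinite_integral_continuous_1) auto
  ultimately show ?thesis
    by (subst continuous_on_cong[OF refl]) auto
qed

lemma borel_measurable_Lagrangian:
  fixes L :: "'a::euclidean_space \<Rightarrow> 'a \<Rightarrow> real"
  assumes L: "(\<lambda>(x, u). L x u) \<in> borel_measurable borel" and [measurable]: "v \<in> borel_measurable borel"
  shows "(\<lambda>s. L (primitive_from x v s) (v s)) \<in> borel_measurable borel"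
proof -
  have "(\<lambda>(x, u). L x u) \<in> borel_measurable (borel \<Otimes>\<^sub>M borel)"
    using L by (simp add: borel_prod)
  from measurable_compose[OF _ this, of "\<lambda>s. (primitive_from x v s, v s)" borel] show ?thesis
    by simp
qed

lemma running_cost_shift:
  fixes L :: "'a::euclidean_space \<Rightarrow> 'a \<Rightarrow> real"
  assumes L: "(\<lambda>(x, u). L x u) \<in> borel_measurable borel"
    and v: "integrable lborel v" and "0 \<le> a" "0 \<le> T"
  shows "running_cost L x v (a + T) =
    running_cost L x v a + running_cost L (primitive_from x v a) (\<lambda>r. v (a + r)) T"
proof -
  have [measurable]: "(\<lambda>s. L (primitive_from x v s) (v s)) \<in> borel_measurable borel"
    using v by (intro borel_measurable_Lagrangian[OF L]) auto
  show ?thesis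
    unfolding running_cost_def using assms
    by (subst set_nn_integral_Ioc_shift)
       (auto simp: indicator_def primitive_from_shift[OF v] intro!: nn_integral_cong arg_cong2[where f="(+)"])
qed

section \<open>Concatenation and splitting of paths\<close>

lemma reach_trans:
  fixes L :: "'a::euclidean_space \<Rightarrow> 'a \<Rightarrow> real"
  assumes L: "(\<lambda>(x, u). L x u) \<in> borel_measurable borel"
    and "reach L x S y c" "reach L y T z d" and ST: "0 \<le> S" "0 \<le> T"
  shows "reach L x (S + T) z (c + d)"
proof -
  obtain v where v: "integrable lborel v" "y = primitive_from x v S" "c = running_cost L x v S"
    using assms by (auto simp: reach_def)
  obtain u where u: "integrable lborel u" "z = primitive_from y u T" "d = running_cost L y u T"
    using assms by (auto simp: reach_def)
  \<comment> \<open>Follow \<open>v\<close> up to and including time \<open>S\<close>, then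
    \<open>u\<close> delayed by \<open>S\<close>. The form \<open>- S + 1 * s\<close> of the
    argument is that of the affine substitution rule used for integrability.\<close>
  define w where "w s = indicator {..S} s *\<^sub>R v s + indicator {S<..} s *\<^sub>R u (- S + 1 * s)" for s
  have w: "integrable lborel w"
    unfolding w_def
    by (intro Bochner_Integration.integrable_add integrable_mult_indicator v
        lborel_integrable_real_affine u) auto
  have 1: "w s = v s" if "s \<le> S" for s
    using that by (simp add: w_def)
  have 2: "w (S + s) = u s" if "0 < s" for s
    using that by (simp add: w_def)
  have y: "primitive_from x w S = y"
    using 1 by (subst primitive_from_cong[of _ _ v]) (auto simp: v)
  have "primitive_from x w (S + T) = z"
    using primitive_from_shift[OF w ST, of x] 2
    by (subst (asm) (3) primitive_from_cong[of _ _ u]) (auto simp: u y)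
  moreover have "running_cost L x w (S + T) = c + d"
    using running_cost_shift[OF L w ST, of x] running_cost_cong[of S w v L x]
      running_cost_cong[of T "\<lambda>r. w (S + r)" u L y] 1 2
    by (simp add: u v y)
  ultimately show ?thesis
    using w by (auto simp: reach_def)
qed

lemma reach_split:
  fixes L :: "'a::euclidean_space \<Rightarrow> 'a \<Rightarrow> real"
  assumes L: "(\<lambda>(x, u). L x u) \<in> borel_measurable borel"
    and "reach L x (S + T) z c" and ST: "0 \<le> S" "0 \<le> T"
  obtains y c1 c2 where "reach L x S y c1" "reach L y T z c2" "c = c1 + c2"
proof -
  obtain v where v: "integrable lborel v" "z = primitive_from x v (S + T)" "c = running_cost L x v (S + T)"
    using assms by (auto simp: reach_def)
  have "integrable lborel (\<lambda>r. v (S + r))"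
    using lborel_integrable_real_affine[OF v(1), of 1 S] by simp
  then have "reach L (primitive_from x v S) T z (running_cost L (primitive_from x v S) (\<lambda>r. v (S + r)) T)"
    unfolding reach_def using v primitive_from_shift[OF v(1) ST] by auto
  moreover have "reach L x S (primitive_from x v S) (running_cost L x v S)"
    using v by (auto simp: reach_def)
  ultimately show ?thesis
    using running_cost_shift[OF L v(1) ST, of x] that v by auto
qed

lemma reach_refl: "reach L x 0 x 0"
proof -
  have "running_cost L x (\<lambda>_. 0) 0 = 0"
    by (simp add: running_cost_def)
  then show ?thesis
    unfolding reach_def by (intro exI[of _ "\<lambda>_. 0"]) auto
qed

text \<open>Every modification of a path in the sequel is made of such constant-velocity pieces; a
  bound on \<open>L\<close> along the segment controls their cost.\<close>

lemma reach_straight: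
  fixes L :: "'a::euclidean_space \<Rightarrow> 'a \<Rightarrow> real"
  assumes h: "0 < h" and M: "\<And>r. 0 < r \<Longrightarrow> r \<le> h \<Longrightarrow> L (x + r *\<^sub>R u) u \<le> M"
  obtains c where "reach L x h (x + h *\<^sub>R u) c" "c \<le> ennreal (h * M)"
proof -
  \<comment> \<open>The cut-off makes the constant velocity integrable on the whole line, as
    \<open>reach\<close> demands.\<close>
  define v where "v = (\<lambda>s. indicator {0<..h} s *\<^sub>R u)"
  have v: "integrable lborel v"
    unfolding v_def by (intro integrable_scaleR_left integrable_real_indicator) (use h in \<open>auto simp: emeasure_lborel_Ioc\<close>)
  have vu: "v s = u" if "0 < s" "s \<le> h" for s
    using that by (simp add: v_def)
  have p: "primitive_from x v s = x + s *\<^sub>R u" if "0 < s" "s \<le> h" for s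
  proof -
    have "primitive_from x v s = primitive_from x (\<lambda>_. u) s"
      using that by (intro primitive_from_cong vu) auto
    then show ?thesis
      using that by (simp add: primitive_from_def set_lebesgue_integral_def)
  qed
  have "running_cost L x v h \<le> (\<integral>\<^sup>+ s\<in>{0<..h}. ennreal M \<partial>lborel)"
    unfolding running_cost_def
    using M by (intro nn_integral_mono) (auto simp: indicator_def p vu intro!: ennreal_leI)
  also have "\<dots> = ennreal (h * M)"
    using h by (simp add: nn_integral_cmult_indicator ennreal_mult'' mult.commute)
  finally have "running_cost L x v h \<le> ennreal (h * M)" .
  moreover have "reach L x h (x + h *\<^sub>R u) (running_cost L x v h)"
    unfolding reach_def using v p[of h] h by (intro exI[of _ v]) auto
  ultimately show ?thesis
    by (rule that[rotated])
qed

text \<open>The displacement is at most the integral of the speed, and the speed is at most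
  \<open>K + L\<close>. Finiteness of \<open>c\<close> matters because \<open>enn2real\<close> sends
  infinity to 0.\<close>

lemma reach_displacement:
  fixes L :: "'a::euclidean_space \<Rightarrow> 'a \<Rightarrow> real"
  assumes Lm: "(\<lambda>(x, u). L x u) \<in> borel_measurable borel"
    and "reach L x T z c" "c \<noteq> \<infinity>" "0 \<le> T"
    and K: "\<And>x u. norm u \<le> K + L x u" "0 \<le> K" and L: "\<And>x u. 0 \<le> L x u"
  shows "norm (z - x) \<le> K * T + enn2real c"
proof -
  obtain v where v: "integrable lborel v" "z = primitive_from x v T" "c = running_cost L x v T"
    using assms by (auto simp: reach_def)
  have [measurable]: "v \<in> borel_measurable borel"
    using v(1) by auto
  note [measurable] = borel_measurable_Lagrangian[OF Lm, of v x]
  have "ennreal (norm (z - x)) \<le> (\<integral>\<^sup>+ s. norm (indicator {0<..T} s *\<^sub>R v s) \<partial>lborel)"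
    unfolding v(2) primitive_from_def set_lebesgue_integral_def
    using v(1) by (simp del: norm_scaleR) (intro integral_norm_bound_ennreal integrable_mult_indicator, auto)
  also have "\<dots> \<le> (\<integral>\<^sup>+ s. ennreal K * indicator {0<..T} s +
      ennreal (L (primitive_from x v s) (v s)) * indicator {0<..T} s \<partial>lborel)"
    using K L by (intro nn_integral_mono) (auto simp: indicator_def simp flip: ennreal_plus intro!: ennreal_leI)
  also have "\<dots> = (\<integral>\<^sup>+ s. ennreal K * indicator {0<..T} s \<partial>lborel) + c"
    unfolding v(3) running_cost_def
    by (intro nn_integral_add) auto
  also have "\<dots> = ennreal (K * T + enn2real c)"
    using assms by (simp add: nn_integral_cmult_indicator ennreal_mult'' ennreal_enn2real_if)
  finally show ?thesis
    using assms by (subst (asm) ennreal_le_iff) auto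
qed

subsection \<open>Sobolev functions as primitives\<close>

lemma set_integrable_Ioo_continuous:
  fixes f :: "real \<Rightarrow> 'a::euclidean_space"
  assumes "continuous_on {a..b} f"
  shows "set_integrable lborel {a<..<b} f"
  by (rule set_integrable_subset[OF borel_integrable_atLeastAtMost'[OF assms]]) auto

lemma set_integral_Ico_FTC:
  fixes f g :: "real \<Rightarrow> real"
  assumes "a \<le> b" and g: "\<And>s. (f has_real_derivative g s) (at s)" "continuous_on UNIV g"
  shows "(LINT s:{a..<b}|lborel. g s) = f b - f a" "(LINT s:{a<..<b}|lborel. g s) = f b - f a"
proof -
  have [measurable]: "g \<in> borel_measurable borel"
    using g(2) by (rule borel_measurable_continuous_onI)
  have 1: "(LINT s:{a..b}|lborel. g s) = f b - f a"
    unfolding set_lebesgue_integral_def using assms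
    by (intro integral_FTC_atLeastAtMost)
      (auto intro: continuous_on_subset has_field_derivative_at_within
        simp flip: has_real_derivative_iff_has_vector_derivative)
  have ne: "AE s in lborel. s \<noteq> a" "AE s in lborel. s \<noteq> b"
    by (rule AE_lborel_singleton)+
  have "(LINT s:{a..<b}|lborel. g s) = (LINT s:{a..b}|lborel. g s)"
    unfolding set_lebesgue_integral_def
    by (rule integral_cong_AE) (use ne in \<open>auto elim!: eventually_elim2 simp: indicator_def\<close>)
  then show "(LINT s:{a..<b}|lborel. g s) = f b - f a"
    by (simp add: 1)
  have "(LINT s:{a<..<b}|lborel. g s) = (LINT s:{a..b}|lborel. g s)"
    unfolding set_lebesgue_integral_def
    by (rule integral_cong_AE) (use ne in \<open>auto elim!: eventually_elim2 simp: indicator_def\<close>)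
  then show "(LINT s:{a<..<b}|lborel. g s) = f b - f a"
    by (simp add: 1)
qed

lemma test_function_props:
  assumes "test_function a b \<psi>"
  shows "\<And>s. (\<psi> has_real_derivative deriv \<psi> s) (at s)" "continuous_on UNIV (deriv \<psi>)"
    "\<And>s. s \<le> a \<or> b \<le> s \<Longrightarrow> \<psi> s = 0"
proof -
  obtain D where D: "\<And>s. (\<psi> has_real_derivative D s) (at s)" "continuous_on UNIV D"
    using assms by (auto simp: test_function_def C1_differentiable_on_def
        has_real_derivative_iff_has_vector_derivative)
  then have "deriv \<psi> = D"
    by (auto simp: DERIV_imp_deriv)
  then show "\<And>s. (\<psi> has_real_derivative deriv \<psi> s) (at s)" "continuous_on UNIV (deriv \<psi>)"
    using D by auto
  have "{s. \<psi> s \<noteq> 0} \<subseteq> {a<..<b}"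
    using assms closure_subset[of "{s. \<psi> s \<noteq> 0}"] unfolding test_function_def
    by (blast intro: subset_trans)
  then show "\<And>s. s \<le> a \<or> b \<le> s \<Longrightarrow> \<psi> s = 0"
    by force
qed

text \<open>This licenses Fubini on the triangle \<open>0 < r \<le> s < t\<close>. The function
  \<open>g\<close> is bounded by some \<open>C\<close> on the compact interval, so the kernel is
  dominated by a product of an integrable function of \<open>r\<close> and an integrable function of
  \<open>s\<close>.\<close>

lemma integrable_triangle_kernel:
  fixes v :: "real \<Rightarrow> 'a::euclidean_space" and g :: "real \<Rightarrow> real"
  assumes v: "integrable lborel v" and g: "continuous_on UNIV g"
  shows "integrable (lborel \<Otimes>\<^sub>M lborel)
    (\<lambda>(r, s). if 0 < r \<and> r \<le> s \<and> s < t then g s *\<^sub>R v r else 0)"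
proof -
  have [measurable]: "v \<in> borel_measurable borel"
    using v by auto
  have [measurable]: "g \<in> borel_measurable borel"
    using g by (rule borel_measurable_continuous_onI)
  have "bounded (g ` {0..t})"
    using g by (intro compact_imp_bounded compact_continuous_image)
      (auto intro: continuous_on_subset)
  then obtain C where C: "\<And>s. s \<in> {0..t} \<Longrightarrow> \<bar>g s\<bar> \<le> C"
    unfolding bounded_iff by fastforce
  have "integrable (lborel \<Otimes>\<^sub>M lborel) (\<lambda>(r, s). norm (v r) * (C * indicator {0<..<t} s))"
  proof (rule lborel_pair.Fubini_integrable)
    have "(LINT s|lborel. norm (norm (v r) * (C * indicator {0<..<t} s))) =
        norm (v r) * (LINT s|lborel. norm (C * indicator {0<..<t} s :: real))" for r
      by (simp add: abs_mult)
    then show "integrable lborel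
        (\<lambda>r. LINT s|lborel. norm (case (r, s) of (r, s) \<Rightarrow> norm (v r) * (C * indicator {0<..<t} s)))"
      using v by simp
    show "AE r in lborel. integrable lborel
        (\<lambda>s. case (r, s) of (r, s) \<Rightarrow> norm (v r) * (C * indicator {0<..<t} s))"
      by (auto intro!: integrable_mult_right integrable_real_indicator
          simp: emeasure_lborel_box_finite[of 0 t, simplified])
  qed measurable
  then show ?thesis
  proof (rule Bochner_Integration.integrable_bound)
    have "norm (if 0 < r \<and> r \<le> s \<and> s < t then g s *\<^sub>R v r else 0)
        \<le> norm (norm (v r) * (C * indicator {0<..<t} s))" for r s
    proof (cases "0 < r \<and> r \<le> s \<and> s < t")
      case True
      then have "\<bar>g s\<bar> \<le> \<bar>C\<bar>"
        using C[of s] by auto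
      then have "\<bar>g s\<bar> * norm (v r) \<le> \<bar>C\<bar> * norm (v r)"
        by (rule mult_right_mono) auto
      with True show ?thesis
        by (simp add: abs_mult mult.commute)
    qed auto
    then show "AE x in lborel \<Otimes>\<^sub>M lborel.
       norm (case x of (r, s) \<Rightarrow> if 0 < r \<and> r \<le> s \<and> s < t then g s *\<^sub>R v r else 0)
       \<le> norm (case x of (r, s) \<Rightarrow> norm (v r) * (C * indicator {0<..<t} s))"
      by auto
  qed measurable
qed

text \<open>Integration by parts through Fubini: \<open>deriv \<psi> s *\<^sub>R v r\<close> is
  integrated over the triangle \<open>0 < r \<le> s < t\<close> in both orders.\<close>

lemma has_W11_derivative_primitive_from:
  fixes v :: "real \<Rightarrow> 'a::euclidean_space"
  assumes v: "integrable lborel v"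
  shows "has_W11_derivative 0 t (primitive_from x v) v"
  unfolding has_W11_derivative_def
proof (intro conjI allI impI)
  show "set_integrable lborel {0<..<t} v"
    unfolding set_integrable_def using v by (intro integrable_mult_indicator) auto
  show "set_integrable lborel {0<..<t} (primitive_from x v)"
    by (intro set_integrable_Ioo_continuous continuous_on_primitive_from v)
  fix \<psi> assume \<psi>: "test_function 0 t \<psi>"
  note t = test_function_props[OF \<psi>]
  define f where "f r s = (if 0 < r \<and> r \<le> s \<and> s < t then deriv \<psi> s *\<^sub>R v r else 0)" for r s
  have f: "integrable (lborel \<Otimes>\<^sub>M lborel) (\<lambda>(r, s). f r s)"
    unfolding f_def by (rule integrable_triangle_kernel[OF v t(2)])
  \<comment> \<open>Integrating in \<open>r\<close> first recovers the primitive, without its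
    starting point \<open>x\<close>.\<close>
  have inner1: "(LINT r|lborel. f r s) = indicator {0<..<t} s *\<^sub>R deriv \<psi> s *\<^sub>R (primitive_from x v s - x)" for s
  proof -
    have "(LINT r|lborel. f r s) =
        (LINT r|lborel. (indicator {0<..<t} s * deriv \<psi> s) *\<^sub>R (indicator {0<..s} r *\<^sub>R v r))"
      by (intro Bochner_Integration.integral_cong) (auto simp: f_def indicator_def)
    also have "\<dots> = (indicator {0<..<t} s * deriv \<psi> s) *\<^sub>R (LINT r|lborel. indicator {0<..s} r *\<^sub>R v r)"
      by (rule integral_scaleR_right)
    finally show ?thesis
      by (simp add: primitive_from_def set_lebesgue_integral_def)
  qed
  \<comment> \<open>Integrating in \<open>s\<close> first gives \<open>\<psi> t - \<psi> r\<close>,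
    where \<open>\<psi> t = 0\<close>.\<close>
  have inner2: "(LINT s|lborel. f r s) = - (indicator {0<..<t} r *\<^sub>R \<psi> r *\<^sub>R v r)" for r
  proof (cases "0 < r \<and> r < t")
    case True
    then have "(LINT s|lborel. f r s) = (LINT s|lborel. (indicator {r..<t} s *\<^sub>R deriv \<psi> s) *\<^sub>R v r)"
      by (intro Bochner_Integration.integral_cong) (auto simp: f_def indicator_def)
    also have "\<dots> = (LINT s:{r..<t}|lborel. deriv \<psi> s) *\<^sub>R v r"
      unfolding set_lebesgue_integral_def
      by (rule integral_scaleR_left)
        (use set_integrable_subset[OF borel_integrable_atLeastAtMost'[OF continuous_on_subset[OF t(2)]], of r t "{r..<t}"]
          in \<open>simp add: set_integrable_def atLeastLessThan_subseteq_atLeastAtMost_iff\<close>)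
    also have "\<dots> = - (\<psi> r *\<^sub>R v r)"
      using True by (subst set_integral_Ico_FTC[OF _ t(1,2)]) (auto simp: t(3))
    finally show ?thesis
      using True by simp
  next
    case False
    then have "f r s = 0" for s
      by (auto simp: f_def)
    with False show ?thesis
      by (auto simp: indicator_def)
  qed
  have "(LINT s:{0<..<t}|lborel. deriv \<psi> s *\<^sub>R (primitive_from x v s - x)) =
      - (LINT s:{0<..<t}|lborel. \<psi> s *\<^sub>R v s)"
    using lborel_pair.Fubini_integral[OF f] unfolding set_lebesgue_integral_def inner1 inner2
    by simp
  moreover have "(LINT s:{0<..<t}|lborel. deriv \<psi> s *\<^sub>R primitive_from x v s) =
      (LINT s:{0<..<t}|lborel. deriv \<psi> s *\<^sub>R (primitive_from x v s - x)) +
      (LINT s:{0<..<t}|lborel. deriv \<psi> s *\<^sub>R x)"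
  proof (subst set_integral_add(2)[symmetric])
    show "set_integrable lborel {0<..<t} (\<lambda>s. deriv \<psi> s *\<^sub>R (primitive_from x v s - x))"
      "set_integrable lborel {0<..<t} (\<lambda>s. deriv \<psi> s *\<^sub>R x)"
      by (intro set_integrable_Ioo_continuous continuous_intros continuous_on_primitive_from v
          continuous_on_subset[OF t(2)]; simp)+
  qed (simp add: algebra_simps)
  \<comment> \<open>The starting point contributes nothing, since \<open>\<psi>\<close> vanishes at
    both ends.\<close>
  moreover have "(LINT s:{0<..<t}|lborel. deriv \<psi> s *\<^sub>R x) = 0"
  proof (cases "0 \<le> t")
    case True
    have "set_integrable lborel {0<..<t} (deriv \<psi>)"
      by (intro set_integrable_Ioo_continuous continuous_on_subset[OF t(2)]) auto
    then have "(LINT s:{0<..<t}|lborel. deriv \<psi> s *\<^sub>R x) = (LINT s:{0<..<t}|lborel. deriv \<psi> s) *\<^sub>R x"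
      unfolding set_lebesgue_integral_def set_integrable_def
      by (subst integral_scaleR_left[symmetric]) auto
    also have "(LINT s:{0<..<t}|lborel. deriv \<psi> s) = 0"
      using True by (subst set_integral_Ico_FTC[OF _ t(1,2)]) (auto simp: t(3))
    finally show ?thesis
      by simp
  qed (simp add: set_lebesgue_integral_def)
  ultimately show "(LINT s:{0<..<t}|lborel. deriv \<psi> s *\<^sub>R primitive_from x v s) =
      - (LINT s:{0<..<t}|lborel. \<psi> s *\<^sub>R v s)"
    by simp
qed

text \<open>A \<open>C\<^sup>1\<close> step rising from \<open>0\<close> to \<open>2 * e\<^sup>2\<close> across \<open>[-e, e]\<close>, and its derivative. The difference
  of two translates of the step is a test function, so that testing with it compares local averages
  at two points.\<close>

definition step_fun :: "real \<Rightarrow> real \<Rightarrow> real" where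
  "step_fun e s = (max 0 (s + e))\<^sup>2 - 2 * (max 0 s)\<^sup>2 + (max 0 (s - e))\<^sup>2"

definition hat_fun :: "real \<Rightarrow> real \<Rightarrow> real" where
  "hat_fun e s = 2 * max 0 (s + e) - 4 * max 0 s + 2 * max 0 (s - e)"

lemma DERIV_max_0_power2: "((\<lambda>s::real. (max 0 s)\<^sup>2) has_real_derivative 2 * max 0 s) (at s)"
proof (cases "s = 0")
  case True
  \<comment> \<open>At the kink the difference quotient of the square is \<open>max 0 h\<close>
    itself.\<close>
  have "((\<lambda>h. max 0 h) \<longlongrightarrow> (0::real)) (at 0)"
    using tendsto_max[OF tendsto_const[of 0] tendsto_ident_at[of "0::real" UNIV]] by simp
  moreover have "eventually (\<lambda>h::real. max 0 h = ((max 0 (0 + h))\<^sup>2 - (max 0 0)\<^sup>2) / h) (at 0)"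
    unfolding eventually_at by (intro exI[of _ 1]) (auto simp: max_def power2_eq_square)
  ultimately show ?thesis
    using True by (auto simp: DERIV_def dest: tendsto_cong[THEN iffD1, rotated])
next
  case False
  show ?thesis
  proof (cases "0 < s")
    case True
    have "((\<lambda>s::real. s\<^sup>2) has_real_derivative 2 * max 0 s) (at s)"
      using True by (auto intro!: derivative_eq_intros)
    then show ?thesis
      by (rule has_field_derivative_transform_within_open[where S="{0<..}"]) (use True in auto)
  next
    case 2: False
    have "((\<lambda>s::real. 0) has_real_derivative 2 * max 0 s) (at s)"
      using 2 by (auto intro!: derivative_eq_intros)
    then show ?thesis
      by (rule has_field_derivative_transform_within_open[where S="{..<0}"]) (use 2 False in auto)
  qed
qed

lemma DERIV_step_fun: "((\<lambda>s. step_fun e (s - c)) has_real_derivative hat_fun e (s - c)) (at s)"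
proof -
  have *: "((\<lambda>s. (max 0 (s - c + d))\<^sup>2) has_real_derivative 2 * max 0 (s - c + d)) (at s)" for d
  proof -
    have "((\<lambda>s. s - c + d) has_real_derivative 1) (at s)"
      by (auto intro!: derivative_eq_intros)
    from DERIV_chain2[OF DERIV_max_0_power2 this] show ?thesis
      by simp
  qed
  show ?thesis
    unfolding step_fun_def hat_fun_def
    using DERIV_add[OF DERIV_diff[OF *[of e] DERIV_cmult[OF *[of 0], of 2]] *[of "- e"]]
    by (simp add: algebra_simps)
qed

lemma continuous_on_hat_fun: "continuous_on S (\<lambda>s. hat_fun e (s - c))"
  unfolding hat_fun_def by (intro continuous_intros)

lemma step_fun_left: "0 < e \<Longrightarrow> s \<le> - e \<Longrightarrow> step_fun e s = 0"
  by (simp add: step_fun_def max_def)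

lemma step_fun_right: "0 < e \<Longrightarrow> e \<le> s \<Longrightarrow> step_fun e s = 2 * e\<^sup>2"
  by (simp add: step_fun_def max_def power2_eq_square algebra_simps)

text \<open>To the left of both transition zones the two translates are 0, to the right both equal
  \<open>2 * e\<^sup>2\<close>. They cancel there, which makes the support compact.\<close>

lemma test_function_step_fun:
  assumes e: "0 < e" and "a < c - e" "c + e < b" "a < d - e" "d + e < b"
  shows "test_function a b (\<lambda>s. step_fun e (s - c) - step_fun e (s - d))"
    "deriv (\<lambda>s. step_fun e (s - c) - step_fun e (s - d)) s = hat_fun e (s - c) - hat_fun e (s - d)"
proof -
  let ?f = "\<lambda>s. step_fun e (s - c) - step_fun e (s - d)"
  have D: "(?f has_real_derivative hat_fun e (s - c) - hat_fun e (s - d)) (at s)" for s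
    by (intro derivative_intros DERIV_step_fun)
  then show "deriv ?f s = hat_fun e (s - c) - hat_fun e (s - d)"
    by (rule DERIV_imp_deriv)
  have "{s. ?f s \<noteq> 0} \<subseteq> {min c d - e..max c d + e}"
  proof (rule subsetI, rule ccontr)
    fix s assume s: "s \<in> {s. ?f s \<noteq> 0}" "s \<notin> {min c d - e..max c d + e}"
    then have "(s - c \<le> - e \<and> s - d \<le> - e) \<or> (e \<le> s - c \<and> e \<le> s - d)"
      by auto
    then have "?f s = 0"
      using e by (auto simp: step_fun_left step_fun_right)
    with s show False
      by simp
  qed
  then have cl: "closure {s. ?f s \<noteq> 0} \<subseteq> {min c d - e..max c d + e}"
    by (intro closure_minimal) auto
  then have "compact (closure {s. ?f s \<noteq> 0})"
    using bounded_subset[OF compact_imp_bounded[OF compact_Icc] cl]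
    by (simp add: compact_eq_bounded_closed)
  moreover have "closure {s. ?f s \<noteq> 0} \<subseteq> {a<..<b}"
    by (rule subset_trans[OF cl]) (use assms in auto)
  moreover have "?f C1_differentiable_on UNIV"
    unfolding C1_differentiable_on_def has_real_derivative_iff_has_vector_derivative[symmetric]
    by (intro exI[of _ "\<lambda>s. hat_fun e (s - c) - hat_fun e (s - d)"] conjI ballI D
        continuous_intros continuous_on_hat_fun)
  ultimately show "test_function a b ?f"
    by (auto simp: test_function_def)
qed

text \<open>The hat is nonnegative, lives on \<open>\<bar>s - c\<bar> < e\<close> and has mass
  \<open>2 * e\<^sup>2\<close>, the height of the step. Up to this factor the integral is thus an
  average of values of \<open>w\<close> near \<open>c\<close>.\<close>

lemma hat_fun_average:
  fixes w :: "real \<Rightarrow> 'a::euclidean_space"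
  assumes w: "continuous_on {a..b} w" and e: "0 < e" "a < c - e" "c + e < b"
    and \<eta>: "\<And>s. \<bar>s - c\<bar> < e \<Longrightarrow> norm (w s - w c) \<le> \<eta>"
  shows "norm ((LINT s:{a<..<b}|lborel. hat_fun e (s - c) *\<^sub>R w s) - (2 * e\<^sup>2) *\<^sub>R w c) \<le> 2 * e\<^sup>2 * \<eta>"
proof -
  have nn: "0 \<le> hat_fun e s" for s
    using e by (auto simp: hat_fun_def max_def)
  have z: "hat_fun e s = 0" if "\<not> \<bar>s\<bar> < e" for s
    using that e by (auto simp: hat_fun_def max_def)
  have I: "(LINT s:{a<..<b}|lborel. hat_fun e (s - c)) = 2 * e\<^sup>2"
    using e by (subst set_integral_Ico_FTC(2)[OF _ DERIV_step_fun continuous_on_hat_fun])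
      (auto simp: step_fun_left step_fun_right)
  note int = set_integrable_Ioo_continuous
  note ci = continuous_intros continuous_on_hat_fun w
  have "(LINT s:{a<..<b}|lborel. hat_fun e (s - c) *\<^sub>R w c) = (2 * e\<^sup>2) *\<^sub>R w c"
    using int[OF continuous_on_hat_fun, of a b e c] unfolding I[symmetric] set_lebesgue_integral_def set_integrable_def
    by (subst integral_scaleR_left[symmetric]) auto
  then have "(LINT s:{a<..<b}|lborel. hat_fun e (s - c) *\<^sub>R w s) - (2 * e\<^sup>2) *\<^sub>R w c =
      (LINT s:{a<..<b}|lborel. hat_fun e (s - c) *\<^sub>R w s - hat_fun e (s - c) *\<^sub>R w c)"
    by (subst set_integral_diff(2)) (auto intro!: int ci)
  also have "norm \<dots> \<le> (LINT s:{a<..<b}|lborel. norm (hat_fun e (s - c) *\<^sub>R w s - hat_fun e (s - c) *\<^sub>R w c))"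
    by (intro set_integral_norm_bound int ci)
  also have "\<dots> \<le> (LINT s:{a<..<b}|lborel. hat_fun e (s - c) * \<eta>)"
  proof (rule set_integral_mono)
    fix s
    have "hat_fun e (s - c) * norm (w s - w c) \<le> hat_fun e (s - c) * \<eta>"
    proof (cases "\<bar>s - c\<bar> < e")
      case True
      then show ?thesis using \<eta>[of s] nn by (intro mult_left_mono) auto
    qed (simp add: z)
    then show "norm (hat_fun e (s - c) *\<^sub>R w s - hat_fun e (s - c) *\<^sub>R w c) \<le> hat_fun e (s - c) * \<eta>"
      using nn[of "s - c"] by (simp flip: scaleR_diff_right)
  qed (intro int ci)+
  also have "\<dots> = 2 * e\<^sup>2 * \<eta>"
    by (simp add: I)
  finally show ?thesis .
qed

text \<open>A continuous function with zero weak derivative is constant: testing with a difference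
  of two steps shows that the hat averages at \<open>c\<close> and \<open>d\<close> agree, and these
  are close to \<open>w c\<close> and \<open>w d\<close>.\<close>

lemma du_Bois_Reymond:
  fixes w :: "real \<Rightarrow> 'a::euclidean_space"
  assumes w: "continuous_on {a..b} w"
    and 0: "\<And>\<psi>. test_function a b \<psi> \<Longrightarrow> (LINT s:{a<..<b}|lborel. deriv \<psi> s *\<^sub>R w s) = 0"
    and cd: "a < c" "c < b" "a < d" "d < b"
  shows "w c = w d"
proof -
  have "norm (w c - w d) \<le> 2 * \<eta>" if "0 < \<eta>" for \<eta>
  proof -
    have cont: "isCont w c" "isCont w d"
      using w cd by (auto intro!: continuous_on_interior[OF w])
    obtain e1 where e1: "e1 > 0" "\<And>s. \<bar>s - c\<bar> < e1 \<Longrightarrow> norm (w s - w c) \<le> \<eta>"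
      using cont(1) \<open>0 < \<eta>\<close> 
      unfolding continuous_at_eps_delta dist_norm by (fastforce simp: less_imp_le)
    obtain e2 where e2: "e2 > 0" "\<And>s. \<bar>s - d\<bar> < e2 \<Longrightarrow> norm (w s - w d) \<le> \<eta>"
      using cont(2) \<open>0 < \<eta>\<close> 
      unfolding continuous_at_eps_delta dist_norm by (fastforce simp: less_imp_le)
    \<comment> \<open>Small enough for continuity at both points and for both hats to stay inside
      \<open>(a, b)\<close>.\<close>
    define e where "e = min (min e1 e2) (min (min ((c - a) / 2) ((b - c) / 2)) (min ((d - a) / 2) ((b - d) / 2)))"
    have e: "e \<le> e1" "e \<le> e2" "e \<le> (c - a) / 2" "e \<le> (b - c) / 2" "e \<le> (d - a) / 2" "e \<le> (b - d) / 2"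
      unfolding e_def by linarith+
    have "0 < e"
      using e1 e2 cd by (auto simp: e_def)
    have le: "a < c - e" "c + e < b" "a < d - e" "d + e < b"
      using e \<open>0 < e\<close> cd by (auto simp: field_simps)
    let ?I = "\<lambda>c. LINT s:{a<..<b}|lborel. hat_fun e (s - c) *\<^sub>R w s"
    have "(LINT s:{a<..<b}|lborel. (hat_fun e (s - c) - hat_fun e (s - d)) *\<^sub>R w s) = 0"
      using 0[OF test_function_step_fun(1)[OF \<open>0 < e\<close> le]]
      unfolding test_function_step_fun(2)[OF \<open>0 < e\<close> le] .
    then have eq: "?I c = ?I d"
      unfolding scaleR_diff_left
      by (subst (asm) set_integral_diff(2))
        (auto intro!: set_integrable_Ioo_continuous continuous_intros continuous_on_hat_fun w)
    have "norm (?I c - (2 * e\<^sup>2) *\<^sub>R w c) \<le> 2 * e\<^sup>2 * \<eta>" "norm (?I d - (2 * e\<^sup>2) *\<^sub>R w d) \<le> 2 * e\<^sup>2 * \<eta>"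
      using e e1 e2 by (intro hat_fun_average w \<open>0 < e\<close> le; simp)+
    then have "norm ((?I d - (2 * e\<^sup>2) *\<^sub>R w d) - (?I c - (2 * e\<^sup>2) *\<^sub>R w c)) \<le> 2 * e\<^sup>2 * \<eta> + 2 * e\<^sup>2 * \<eta>"
      by (meson add_mono norm_triangle_ineq4 order_trans)
    also have "(?I d - (2 * e\<^sup>2) *\<^sub>R w d) - (?I c - (2 * e\<^sup>2) *\<^sub>R w c) = (2 * e\<^sup>2) *\<^sub>R (w c - w d)"
      by (simp add: eq algebra_simps)
    finally have "(2 * e\<^sup>2) * norm (w c - w d) \<le> (2 * e\<^sup>2) * (2 * \<eta>)"
      by simp
    then show ?thesis
      using \<open>0 < e\<close> by (subst (asm) mult_le_cancel_left_pos) auto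
  qed
  \<comment> \<open>For distinct values this choice would bound \<open>norm (w c - w d)\<close> by
    half of itself.\<close>
  from this[of "norm (w c - w d) / 4"] show ?thesis
    by (cases "w c = w d") auto
qed

text \<open>The difference of \<open>y\<close> and the primitive has zero weak derivative, hence is
  constant, and it vanishes at time 0. As \<open>v\<close> is controlled only on the open interval,
  \<open>u\<close> extends it by zero.\<close>

lemma has_W11_derivative_imp_primitive_from:
  fixes y v :: "real \<Rightarrow> 'a::euclidean_space"
  assumes y: "continuous_on {0..t} y" and W: "has_W11_derivative 0 t y v" and "0 < t"
  defines "u \<equiv> \<lambda>s. indicator {0<..<t} s *\<^sub>R v s"
  shows "integrable lborel u" "\<And>s. 0 \<le> s \<Longrightarrow> s \<le> t \<Longrightarrow> y s = primitive_from (y 0) u s"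
proof -
  show u: "integrable lborel u"
    using W by (simp add: has_W11_derivative_def set_integrable_def u_def)
  define p where "p = primitive_from (y 0) u"
  have p: "continuous_on {0..t} p"
    unfolding p_def by (rule continuous_on_primitive_from[OF u])
  define w where "w s = y s - p s" for s
  have w: "continuous_on {0..t} w"
    unfolding w_def by (intro continuous_intros y p)
  have "(LINT s:{0<..<t}|lborel. deriv \<psi> s *\<^sub>R w s) = 0" if \<psi>: "test_function 0 t \<psi>" for \<psi>
  proof -
    note t = test_function_props[OF \<psi>]
    have "(LINT s:{0<..<t}|lborel. deriv \<psi> s *\<^sub>R w s) =
        (LINT s:{0<..<t}|lborel. deriv \<psi> s *\<^sub>R y s) - (LINT s:{0<..<t}|lborel. deriv \<psi> s *\<^sub>R p s)"
      unfolding w_def scaleR_diff_right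
      by (intro set_integral_diff set_integrable_Ioo_continuous continuous_intros y p
          continuous_on_subset[OF t(2)]) auto
    moreover have "(LINT s:{0<..<t}|lborel. \<psi> s *\<^sub>R u s) = (LINT s:{0<..<t}|lborel. \<psi> s *\<^sub>R v s)"
      by (intro set_lebesgue_integral_cong) (auto simp: u_def)
    ultimately show ?thesis
      using W has_W11_derivative_primitive_from[OF u, of t "y 0"] \<psi>
      by (simp add: has_W11_derivative_def p_def)
  qed
  note const = du_Bois_Reymond[OF w this]
  define m where "m = t / 2"
  have m: "w s = w m" if "s \<in> {0..t}" for s
  \<comment> \<open>Constancy is known at interior points only; continuity carries it to the
    endpoints.\<close>
  proof (rule continuous_constant_on_closure[where S="{0<..<t}"])
    show "continuous_on (closure {0<..<t}) w"
      using w \<open>0 < t\<close> by simp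
    show "s \<in> closure {0<..<t}"
      using that \<open>0 < t\<close> by simp
  qed (use const \<open>0 < t\<close> in \<open>auto simp: m_def\<close>)
  show "y s = primitive_from (y 0) u s" if "0 \<le> s" "s \<le> t" for s
  proof -
    have "w s = w 0"
      using that \<open>0 < t\<close> m[of s] m[of 0] by simp
    also have "w 0 = 0"
      by (simp add: w_def p_def)
    finally show ?thesis
      by (simp add: w_def p_def)
  qed
qed

text \<open>The two sets of total costs coincide, not merely their infima, because Sobolev functions
  with their continuous representative are exactly the primitives.\<close>

lemma value_function_eq_Inf_reach:
  assumes t: "0 < t"
  shows "value_function L \<phi> t x = Inf {c + \<phi> z | c z. reach L x t z c}"
proof -
  have cost: "(\<integral>\<^sup>+ s\<in>{0..t}. ennreal (L (y s) (v s)) \<partial>lborel) = running_cost L x u t"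
    if "\<And>s. 0 < s \<Longrightarrow> s < t \<Longrightarrow> y s = primitive_from x u s \<and> v s = u s" for y v u
  proof -
    \<comment> \<open>The endpoints, where velocities and intervals may disagree, are negligible for
      the cost.\<close>
    have ne: "AE s in lborel. s \<noteq> 0" "AE s in lborel. s \<noteq> t"
      by (rule AE_lborel_singleton)+
    show ?thesis
      unfolding running_cost_def
    proof (rule nn_integral_cong_AE)
      show "AE s in lborel. ennreal (L (y s) (v s)) * indicator {0..t} s =
          ennreal (L (primitive_from x u s) (u s)) * indicator {0<..t} s"
        using ne by eventually_elim (use that in \<open>auto simp: indicator_def\<close>)
    qed
  qed
  have "{(\<integral>\<^sup>+ s \<in> {0..t}. ennreal (L (y s) (v s)) \<partial>lborel) + \<phi> (y t) | y v.
      continuous_on {0..t} y \<and> has_W11_derivative 0 t y v \<and> y 0 = x} = {c + \<phi> z | c z. reach L x t z c}"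
  proof (intro set_eqI iffI)
    fix k assume "k \<in> {(\<integral>\<^sup>+ s \<in> {0..t}. ennreal (L (y s) (v s)) \<partial>lborel) + \<phi> (y t) | y v.
      continuous_on {0..t} y \<and> has_W11_derivative 0 t y v \<and> y 0 = x}"
    then obtain y v where k: "k = (\<integral>\<^sup>+ s \<in> {0..t}. ennreal (L (y s) (v s)) \<partial>lborel) + \<phi> (y t)"
      and y: "continuous_on {0..t} y" "has_W11_derivative 0 t y v" and "y 0 = x"
      by blast
    define u where "u s = indicator {0<..<t} s *\<^sub>R v s" for s
    note u = has_W11_derivative_imp_primitive_from[OF y t, folded u_def, unfolded \<open>y 0 = x\<close>]
    have "reach L x t (y t) (running_cost L x u t)"
      unfolding reach_def using u t by (intro exI[of _ u]) auto
    moreover have "(\<integral>\<^sup>+ s\<in>{0..t}. ennreal (L (y s) (v s)) \<partial>lborel) = running_cost L x u t"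
      by (rule cost) (simp add: u(2) del: u_def, simp add: u_def)
    ultimately show "k \<in> {c + \<phi> z | c z. reach L x t z c}"
      by (auto simp: k)
  next
    fix k assume "k \<in> {c + \<phi> z | c z. reach L x t z c}"
    then obtain v where v: "integrable lborel v"
      and k: "k = running_cost L x v t + \<phi> (primitive_from x v t)"
      by (auto simp: reach_def)
    have "k = (\<integral>\<^sup>+ s \<in> {0..t}. ennreal (L (primitive_from x v s) (v s)) \<partial>lborel) + \<phi> (primitive_from x v t)"
      unfolding k by (subst cost[of _ v]) auto
    then show "k \<in> {(\<integral>\<^sup>+ s \<in> {0..t}. ennreal (L (y s) (v s)) \<partial>lborel) + \<phi> (y t) | y v.
      continuous_on {0..t} y \<and> has_W11_derivative 0 t y v \<and> y 0 = x}"
      using continuous_on_primitive_from[OF v] has_W11_derivative_primitive_from[OF v] by force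
  qed
  then show ?thesis
    by (simp add: value_function_def)
qed

subsection \<open>Lipschitz estimates\<close>

lemma locally_bounded_imp_bounded_compact:
  assumes f: "locally_bounded f" and S: "compact S"
  shows "bounded (f ` S)"
proof -
  obtain e where e: "\<And>x. 0 < e x" "\<And>x. bounded (f ` ball x (e x))"
    using f unfolding locally_bounded_def by metis
  obtain D where D: "finite D" "S \<subseteq> (\<Union>x\<in>D. ball x (e x))"
  proof (rule compactE_image[OF S, of S "\<lambda>x. ball x (e x)"])
    show "S \<subseteq> (\<Union>x\<in>S. ball x (e x))"
      using e(1) by force
  qed auto
  have "bounded (\<Union>x\<in>D. f ` ball x (e x))"
    using D e by auto
  then show ?thesis
    by (rule bounded_subset) (use D(2) in blast)
qed

lemma Lagrangian_bound:
  fixes L :: "'a::euclidean_space \<Rightarrow> 'a \<Rightarrow> real"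
  assumes "locally_bounded (\<lambda>(x, u). L x u)"
  obtains M where "0 \<le> M" "\<And>x u. norm x \<le> R \<Longrightarrow> norm u \<le> U \<Longrightarrow> L x u \<le> M"
proof -
  have "bounded ((\<lambda>(x, u). L x u) ` (cball 0 R \<times> cball 0 U))"
    by (intro locally_bounded_imp_bounded_compact assms compact_Times compact_cball)
  then obtain M where M: "\<forall>y\<in>(\<lambda>(x, u). L x u) ` (cball 0 R \<times> cball 0 U). norm y \<le> M"
    unfolding bounded_iff by blast
  show ?thesis
  proof
    \<comment> \<open>The maximum keeps the bound nonnegative even when a ball is empty.\<close>
    show "L x u \<le> max 0 M" if "norm x \<le> R" "norm u \<le> U" for x u
      using that M by (force simp: abs_le_iff)
  qed simp
qed

text \<open>Outside a ball the quotient is at least 1; inside it the constant absorbs the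
  norm.\<close>

lemma superlinear_imp_norm_le:
  fixes \<Theta> :: "'a::euclidean_space \<Rightarrow> real"
  assumes nn: "\<And>u. 0 \<le> \<Theta> u" and "filterlim (\<lambda>u. \<Theta> u / norm u) at_top at_infinity"
  obtains K where "0 \<le> K" "\<And>u. norm u \<le> K + \<Theta> u"
proof -
  have "eventually (\<lambda>u. 1 \<le> \<Theta> u / norm u) at_infinity"
    using assms(2) by (simp add: filterlim_at_top)
  then obtain b where b: "\<And>u. b \<le> norm u \<Longrightarrow> 1 \<le> \<Theta> u / norm u"
    by (auto simp: eventually_at_infinity)
  show ?thesis
  proof
    show "norm u \<le> max 0 b + \<Theta> u" for u
    proof (cases "b \<le> norm u \<and> u \<noteq> 0")
      case True
      then have "norm u \<le> \<Theta> u"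
        using b[of u] by (simp add: le_divide_eq)
      then show ?thesis
        by linarith
    next
      case False
      then show ?thesis
        using nn[of u] by auto
    qed
  qed simp
qed

text \<open>Pigeonhole principle by induction on \<open>N\<close>: cut off an initial piece of
  duration \<open>\<delta>\<close>. Either it is cheap, or removing it lowers the cost by more than
  \<open>\<kappa>\<close> and the rest of the path satisfies the assumption for
  \<open>N\<close>.\<close>

lemma reach_cheap_segment:
  fixes L :: "'a::euclidean_space \<Rightarrow> 'a \<Rightarrow> real"
  assumes Lm: "(\<lambda>(x, u). L x u) \<in> borel_measurable borel" and \<delta>: "0 < \<delta>"
  shows "reach L x T z c \<Longrightarrow> real N * \<delta> \<le> T \<Longrightarrow> c < of_nat N * \<kappa> \<Longrightarrow>
    \<exists>a p q c1 c2 c3. 0 \<le> a \<and> a + \<delta> \<le> T \<and> reach L x a p c1 \<and> reach L p \<delta> q c2 \<and>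
      reach L q (T - a - \<delta>) z c3 \<and> c = c1 + c2 + c3 \<and> c2 \<le> \<kappa>"
proof (induction N arbitrary: x T c)
  case 0
  then show ?case by simp
next
  case (Suc N)
  have T: "real N * \<delta> \<le> T - \<delta>"
    using Suc.prems(2) by (simp add: algebra_simps)
  moreover have "0 \<le> real N * \<delta>"
    using \<delta> by simp
  ultimately have T0: "0 \<le> T - \<delta>"
    by linarith
  have "reach L x (\<delta> + (T - \<delta>)) z c"
    using Suc.prems by simp
  then obtain y d1 d2 where d: "reach L x \<delta> y d1" "reach L y (T - \<delta>) z d2" "c = d1 + d2"
    using T0 \<delta> by (elim reach_split[OF Lm]) auto
  show ?case
  proof (cases "d1 \<le> \<kappa>")
    case True
    show ?thesis
      by (rule exI[of _ 0], rule exI[of _ x], rule exI[of _ y], rule exI[of _ 0], rule exI[of _ d1],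
          rule exI[of _ d2]) (use d True T0 reach_refl[of L x] in auto)
  next
    case False
    have "d2 < of_nat N * \<kappa>"
    proof (rule ccontr)
      assume "\<not> d2 < of_nat N * \<kappa>"
      then have "\<kappa> + of_nat N * \<kappa> \<le> d1 + d2"
        using False by (intro add_mono) auto
      with Suc.prems(3) show False
        by (simp add: d(3) distrib_right)
    qed
    from Suc.IH[OF d(2) T this] obtain a p q c1 c2 c3 where
      *: "0 \<le> a" "a + \<delta> \<le> T - \<delta>" "reach L y a p c1" "reach L p \<delta> q c2"
        "reach L q (T - \<delta> - a - \<delta>) z c3" "d2 = c1 + c2 + c3" "c2 \<le> \<kappa>"
      by blast
    have "reach L x (\<delta> + a) p (d1 + c1)"
      using reach_trans[OF Lm d(1) *(3)] * \<delta> by simp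
    moreover have "T - \<delta> - a - \<delta> = T - (\<delta> + a) - \<delta>"
      by simp
    ultimately show ?thesis
      using * d(3) \<delta>
      by (intro exI[of _ "\<delta> + a"] exI[of _ p] exI[of _ q] exI[of _ "d1 + c1"] exI[of _ c2] exI[of _ c3])
        (simp add: add.assoc)
  qed
qed

text \<open>A piece of duration \<open>2 * h\<close> with cost at most
  \<open>4 * h * (G + 1) / T\<close> has displacement of order \<open>h\<close>. Covering it in time
  \<open>h\<close> therefore needs a speed bounded independently of \<open>h\<close>, which is why
  the region where \<open>M\<close> bounds \<open>L\<close> does not involve
  \<open>h\<close>.\<close>

lemma reach_speed_up:
  fixes L :: "'a::euclidean_space \<Rightarrow> 'a \<Rightarrow> real"
  assumes Lm: "(\<lambda>(x, u). L x u) \<in> borel_measurable borel" and L: "\<And>x u. 0 \<le> L x u"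
    and K: "0 \<le> K" "\<And>x u. norm u \<le> K + L x u"
    and r: "reach L x T z c" and c: "c \<le> ennreal G" and G: "0 \<le> G" and h: "0 < h" "2 * h \<le> T"
    and M: "\<And>p u. norm (p - x) \<le> K * T + G \<Longrightarrow> norm u \<le> 2 * K + 4 * (G + 1) / T \<Longrightarrow> L p u \<le> M"
  obtains c' where "reach L x (T - h) z c'" "c' \<le> c + ennreal (h * M)"
proof -
  \<comment> \<open>The number of pieces of duration \<open>2 * h\<close> that fit into
    \<open>T\<close>. As \<open>2 * h \<le> T\<close>, it is at least 1, so that rounding down loses
    at most a factor 2.\<close>
  define N where "N = nat \<lfloor>T / (2 * h)\<rfloor>"
  have T: "0 < T"
    using h by linarith
  have ge1: "1 \<le> T / (2 * h)"
    using h by simp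
  then have N1: "1 \<le> N"
    unfolding N_def by (simp add: le_nat_iff le_floor_iff)
  have rN: "real N = of_int \<lfloor>T / (2 * h)\<rfloor>"
    using N1 unfolding N_def by simp
  have "real N \<le> T / (2 * h)" "T / (2 * h) < real N + 1"
    unfolding rN by linarith+
  then have N: "real N * (2 * h) \<le> T" "T \<le> real N * (4 * h)"
  proof -
    show "real N * (2 * h) \<le> T"
      using \<open>real N \<le> T / (2 * h)\<close> h by (simp add: field_simps)
    have "T / (2 * h) \<le> real N * 2"
      using \<open>T / (2 * h) < real N + 1\<close> N1 by simp
    then show "T \<le> real N * (4 * h)"
      using h by (simp add: field_simps)
  qed
  \<comment> \<open>The summand 1 yields the strict inequality \<open>c < N * \<kappa>\<close> that
    the pigeonhole principle asks for.\<close>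
  define \<kappa> where "\<kappa> = (G + 1) / real N"
  have \<kappa>: "0 \<le> \<kappa>" "\<kappa> \<le> 4 * h * (G + 1) / T"
  proof -
    show "0 \<le> \<kappa>"
      using G by (simp add: \<kappa>_def)
    have "(G + 1) * T \<le> (G + 1) * (real N * (4 * h))"
      using N G by (intro mult_left_mono) auto
    then show "\<kappa> \<le> 4 * h * (G + 1) / T"
      using N1 T by (simp add: \<kappa>_def field_simps)
  qed
  have "c < of_nat N * ennreal \<kappa>"
  proof -
    have "of_nat N * ennreal \<kappa> = ennreal (real N * \<kappa>)"
      by (simp add: ennreal_mult' ennreal_of_nat_eq_real_of_nat)
    also have "real N * \<kappa> = G + 1"
      using N1 by (simp add: \<kappa>_def)
    finally show ?thesis
      using c G by (auto intro!: le_less_trans[OF c] simp: ennreal_lessI)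
  qed
  then obtain a p q c1 c2 c3 where *: "0 \<le> a" "a + 2 * h \<le> T" "reach L x a p c1" "reach L p (2 * h) q c2"
      "reach L q (T - a - 2 * h) z c3" "c = c1 + c2 + c3" "c2 \<le> ennreal \<kappa>"
    using reach_cheap_segment[OF Lm _ r N(1)] h by fastforce
  have fin: "c1 \<le> ennreal G" "c1 + c2 \<le> ennreal G"
  proof -
    have "c1 \<le> c" "c1 + c2 \<le> c"
      unfolding *(6) by (simp_all add: add.assoc)
    then show "c1 \<le> ennreal G" "c1 + c2 \<le> ennreal G"
      using c by (blast intro: order_trans)+
  qed
  have disp: "norm (z' - x') \<le> K * T' + b" if "reach L x' T' z' b'" "b' \<le> ennreal b" "0 \<le> b" "0 \<le> T'" for x' z' b' b T'
  proof -
    have "b' \<noteq> \<infinity>"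
      using that(2) by (auto simp: top_unique)
    then have "norm (z' - x') \<le> K * T' + enn2real b'"
      using that K L by (intro reach_displacement[OF Lm]) auto
    moreover have "enn2real b' \<le> b"
      using that by (simp add: enn2real_leI)
    ultimately show ?thesis
      by linarith
  qed
  have KT: "K * s \<le> K * T" if "s \<le> T" for s
    using that K by (intro mult_left_mono) auto
  \<comment> \<open>Both ends of the cheap piece are reached within time \<open>T\<close> at cost at
    most \<open>G\<close>. By convexity of the ball the replacing segment stays where
    \<open>M\<close> applies.\<close>
  have p: "p \<in> cball x (K * T + G)"
    using disp[OF *(3) fin(1)] G * KT[of a] h by (simp add: dist_norm norm_minus_commute)
  have "reach L x (a + 2 * h) q (c1 + c2)"
    using reach_trans[OF Lm *(3,4)] * h by simp
  from disp[OF this fin(2)] have q: "q \<in> cball x (K * T + G)"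
    using G * KT[of "a + 2 * h"] h by (simp add: dist_norm norm_minus_commute)
  define u where "u = (q - p) /\<^sub>R h"
  have "norm (q - p) \<le> K * (2 * h) + \<kappa>"
    using disp[OF *(4,7)] \<kappa> h by simp
  also have "\<dots> \<le> h * (2 * K + 4 * (G + 1) / T)"
    using \<kappa>(2) by (simp add: algebra_simps)
  finally have "norm (q - p) / h \<le> 2 * K + 4 * (G + 1) / T"
    using h by (simp add: pos_divide_le_eq mult.commute)
  then have u: "norm u \<le> 2 * K + 4 * (G + 1) / T"
    using h by (simp add: u_def divide_inverse mult.commute)
  have "L (p + s *\<^sub>R u) u \<le> M" if s: "0 < s" "s \<le> h" for s
  proof (rule M[OF _ u])
    have "p + s *\<^sub>R u = (1 - s / h) *\<^sub>R p + (s / h) *\<^sub>R q"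
      by (simp add: u_def algebra_simps divide_inverse)
    also have "\<dots> \<in> cball x (K * T + G)"
      using s h by (intro convexD_alt[OF convex_cball p q]) auto
    finally show "norm (p + s *\<^sub>R u - x) \<le> K * T + G"
      by (simp add: dist_norm norm_minus_commute)
  qed
  then obtain d where d: "reach L p h (p + h *\<^sub>R u) d" "d \<le> ennreal (h * M)"
    using reach_straight[of h L p u M] h by blast
  moreover have "p + h *\<^sub>R u = q"
    using h by (simp add: u_def)
  ultimately have "reach L x (a + h) q (c1 + d)"
    using reach_trans[OF Lm *(3), of h q d] * h by simp
  from reach_trans[OF Lm this *(5)] have "reach L x (T - h) z (c1 + d + c3)"
    using * h by (simp add: algebra_simps)
  moreover have "c1 + d + c3 \<le> c1 + ennreal (h * M) + c3"
    by (intro add_mono d order_refl)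
  \<comment> \<open>Adding back the cost \<open>c2\<close> of the discarded piece restores the full
    cost \<open>c\<close>.\<close>
  moreover have "\<dots> \<le> c1 + ennreal (h * M) + c3 + c2"
    by (rule add_increasing2) auto
  ultimately show ?thesis
    by (intro that[of "c1 + d + c3"]) (auto simp: *(6) ac_simps intro: order_trans)
qed

text \<open>Moving \<open>b\<close> to the other side reduces this to the defining property of the
  infimum. Infinite \<open>b\<close> is treated apart, since
  \<open>\<infinity> - \<infinity>\<close> is \<open>\<infinity>\<close> in
  \<open>ennreal\<close>.\<close>

lemma le_Inf_add_ennreal:
  fixes a b :: ennreal
  assumes "\<And>k. k \<in> S \<Longrightarrow> a \<le> k + b"
  shows "a \<le> Inf S + b"
proof (cases "b = \<infinity>")
  case False
  have "a - b \<le> Inf S"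
  proof (rule Inf_greatest)
    fix k assume "k \<in> S"
    then show "a - b \<le> k"
      using assms[of k] False unfolding ennreal_minus_le_iff by (auto simp: add.commute[of b k])
  qed
  then show ?thesis
    unfolding ennreal_minus_le_iff add.commute[of b "Inf S"] by blast
qed simp

section \<open>Modified paths as inequalities for the value function\<close>

lemma value_function_le:
  "0 < t \<Longrightarrow> reach L x t z c \<Longrightarrow> value_function L \<phi> t x \<le> c + \<phi> z"
  by (auto simp: value_function_eq_Inf_reach intro!: Inf_lower)

text \<open>A straight segment is put in front of an arbitrary competitor. Taking
  \<open>u = 0\<close> means waiting, and a unit vector \<open>u\<close> means moving to a nearby
  point.\<close>

lemma value_function_straight:
  fixes L :: "'a::euclidean_space \<Rightarrow> 'a \<Rightarrow> real"
  assumes Lm: "(\<lambda>(x, u). L x u) \<in> borel_measurable borel" and t: "0 < t" and h: "0 < h"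
    and M: "\<And>s. 0 < s \<Longrightarrow> s \<le> h \<Longrightarrow> L (x + s *\<^sub>R u) u \<le> M"
  shows "value_function L \<phi> (t + h) x \<le> value_function L \<phi> t (x + h *\<^sub>R u) + ennreal (h * M)"
  unfolding value_function_eq_Inf_reach[OF t]
proof (rule le_Inf_add_ennreal)
  fix k assume "k \<in> {c + \<phi> z | c z. reach L (x + h *\<^sub>R u) t z c}"
  then obtain c z where k: "k = c + \<phi> z" "reach L (x + h *\<^sub>R u) t z c"
    by auto
  obtain d where d: "reach L x h (x + h *\<^sub>R u) d" "d \<le> ennreal (h * M)"
    using reach_straight[of h L x u M] h M by blast
  have "value_function L \<phi> (t + h) x \<le> d + c + \<phi> z"
    using reach_trans[OF Lm d(1) k(2)] t h by (intro value_function_le) (auto simp: add.commute)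
  also have "\<dots> \<le> ennreal (h * M) + c + \<phi> z"
    by (intro add_mono d order_refl)
  finally show "value_function L \<phi> (t + h) x \<le> k + ennreal (h * M)"
    by (simp add: k ac_simps)
qed

text \<open>Competitors of total cost at most \<open>G\<close> are sped up; all others are beaten by
  one fixed competitor \<open>k0\<close> below \<open>G\<close>, which exists because the value is
  below \<open>G\<close>.\<close>

lemma value_function_speed_up:
  fixes L :: "'a::euclidean_space \<Rightarrow> 'a \<Rightarrow> real"
  assumes Lm: "(\<lambda>(x, u). L x u) \<in> borel_measurable borel" and L: "\<And>x u. 0 \<le> L x u"
    and K: "0 \<le> K" "\<And>x u. norm u \<le> K + L x u"
    and V: "value_function L \<phi> t x < ennreal G" and G: "0 \<le> G" and h: "0 < h" "2 * h \<le> t"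
    and M: "\<And>p u. norm (p - x) \<le> K * t + G \<Longrightarrow> norm u \<le> 2 * K + 4 * (G + 1) / t \<Longrightarrow> L p u \<le> M"
  shows "value_function L \<phi> (t - h) x \<le> value_function L \<phi> t x + ennreal (h * M)"
proof -
  have t: "0 < t" "0 < t - h"
    using h by linarith+
  let ?S = "{c + \<phi> z | c z. reach L x t z c}"
  have le: "value_function L \<phi> (t - h) x \<le> k + ennreal (h * M)" if k: "k \<in> ?S" "k \<le> ennreal G" for k
  proof -
    obtain c z where c: "k = c + \<phi> z" "reach L x t z c"
      using k by auto
    have "c \<le> ennreal G"
      using k(2) unfolding c by (rule order_trans[rotated]) (rule add_increasing2, auto)
    then obtain c' where c': "reach L x (t - h) z c'" "c' \<le> c + ennreal (h * M)"
      using reach_speed_up[OF Lm L K c(2) _ G h M] by blast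
    have "value_function L \<phi> (t - h) x \<le> c' + \<phi> z"
      using c' t by (intro value_function_le)
    also have "\<dots> \<le> c + ennreal (h * M) + \<phi> z"
      by (intro add_mono c' order_refl)
    finally show ?thesis
      by (simp add: c ac_simps)
  qed
  obtain k0 where k0: "k0 \<in> ?S" "k0 < ennreal G"
    using V unfolding value_function_eq_Inf_reach[OF t(1)] Inf_less_iff by blast
  show ?thesis
    unfolding value_function_eq_Inf_reach[OF t(1)]
  proof (rule le_Inf_add_ennreal)
    fix k assume "k \<in> ?S"
    show "value_function L \<phi> (t - h) x \<le> k + ennreal (h * M)"
    proof (cases "k \<le> ennreal G")
      case True
      with \<open>k \<in> ?S\<close> show ?thesis by (rule le)
    next
      case False
      then have "k0 + ennreal (h * M) \<le> k + ennreal (h * M)"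
        using k0 by (intro add_right_mono) auto
      with le[OF k0(1) less_imp_le[OF k0(2)]] show ?thesis
        by (rule order_trans)
    qed
  qed
qed

text \<open>Running straight to a point \<open>z\<close> with finite \<open>\<phi> z\<close> bounds
  the value, and does so locally uniformly in \<open>(t, x)\<close>.\<close>

lemma value_function_le_straight:
  fixes L :: "'a::euclidean_space \<Rightarrow> 'a \<Rightarrow> real"
  assumes t: "0 < t" and M: "\<And>p. norm p \<le> max (norm x) (norm z) \<Longrightarrow> L p ((z - x) /\<^sub>R t) \<le> M"
  shows "value_function L \<phi> t x \<le> ennreal (t * M) + \<phi> z"
proof -
  let ?u = "(z - x) /\<^sub>R t"
  have "L (x + s *\<^sub>R ?u) ?u \<le> M" if s: "0 < s" "s \<le> t" for s
  proof (rule M)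
    have "x + s *\<^sub>R ?u = (1 - s / t) *\<^sub>R x + (s / t) *\<^sub>R z"
      by (simp add: algebra_simps divide_inverse)
    also have "\<dots> \<in> cball 0 (max (norm x) (norm z))"
      using s t by (intro convexD_alt[OF convex_cball]) auto
    finally show "norm (x + s *\<^sub>R ?u) \<le> max (norm x) (norm z)"
      by simp
  qed
  then obtain c where c: "reach L x t (x + t *\<^sub>R ?u) c" "c \<le> ennreal (t * M)"
    using reach_straight[of t L x ?u M] t by blast
  moreover have "x + t *\<^sub>R ?u = z"
    using t by simp
  ultimately have "value_function L \<phi> t x \<le> c + \<phi> z"
    using t by (intro value_function_le) auto
  also have "\<dots> \<le> ennreal (t * M) + \<phi> z"
    by (intro add_mono c order_refl)
  finally show ?thesis .
qed

lemma value_function_finite: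
  fixes L :: "'a::euclidean_space \<Rightarrow> 'a \<Rightarrow> real"
  assumes "locally_bounded (\<lambda>(x, u). L x u)" and z: "\<phi> z \<noteq> \<infinity>" and t: "0 < t"
  shows "value_function L \<phi> t x < \<infinity>"
proof -
  obtain M where "\<And>p u. norm p \<le> max (norm x) (norm z) \<Longrightarrow> norm u \<le> norm ((z - x) /\<^sub>R t) \<Longrightarrow> L p u \<le> M"
    using Lagrangian_bound[OF assms(1)] by metis
  then have "value_function L \<phi> t x \<le> ennreal (t * M) + \<phi> z"
    by (intro value_function_le_straight t) auto
  also have "\<dots> < \<infinity>"
    using z by (simp add: less_top)
  finally show ?thesis .
qed

text \<open>From \<open>x'\<close> move to \<open>x\<close> at unit speed, which leaves the time
  \<open>t' - norm (x - x')\<close>; then correct the time to \<open>t\<close> by waiting or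
  speeding up. The distance counts twice, once for the move and once for the time it consumes. The
  one-sided estimate suffices, as the two points can be exchanged.\<close>

lemma value_function_lipschitz_near:
  fixes L :: "'a::euclidean_space \<Rightarrow> 'a \<Rightarrow> real"
  assumes Lm: "(\<lambda>(x, u). L x u) \<in> borel_measurable borel" and L: "\<And>x u. 0 \<le> L x u"
    and K: "0 \<le> K" "\<And>x u. norm u \<le> K + L x u"
    and lb: "locally_bounded (\<lambda>(x, u). L x u)" and z: "\<phi> z \<noteq> \<infinity>" and t0: "0 < t0"
  obtains M where "0 \<le> M"
    "\<And>t x t' x'. \<bar>t - t0\<bar> < t0 / 16 \<Longrightarrow> \<bar>t' - t0\<bar> < t0 / 16 \<Longrightarrow> norm (x - x0) \<le> 1 \<Longrightarrow> norm (x' - x0) \<le> 1 \<Longrightarrow>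
      norm (x - x') \<le> t0 / 8 \<Longrightarrow>
      value_function L \<phi> t' x' \<le> value_function L \<phi> t x + ennreal (M * (\<bar>t' - t\<bar> + 2 * norm (x - x')))"
proof -
  let ?V = "value_function L \<phi>"
  \<comment> \<open>\<open>R0\<close> bounds \<open>x\<close>, \<open>z\<close> and
    \<open>z - x\<close> for \<open>x\<close> in the unit ball around \<open>x0\<close>; dividing by
    \<open>t0 / 2\<close> bounds the speed of the straight path to \<open>z\<close>.\<close>
  define R0 where "R0 = norm x0 + 1 + norm z"
  obtain M0 where M0: "0 \<le> M0" "\<And>p u. norm p \<le> R0 \<Longrightarrow> norm u \<le> R0 / (t0 / 2) \<Longrightarrow> L p u \<le> M0"
    using Lagrangian_bound[OF lb] by metis
  \<comment> \<open>The cost of the straight path to \<open>z\<close>, increased by 1 to make the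
    bound strict.\<close>
  define G where "G = 2 * t0 * M0 + enn2real (\<phi> z) + 1"
  have G: "0 \<le> G"
    using M0 t0 by (simp add: G_def)
  have n0: "norm x \<le> norm x0 + 1" if "norm (x - x0) \<le> 1" for x
    using that norm_triangle_ineq2[of x x0] by linarith
  have V: "?V t x < ennreal G" if t: "t0 / 2 \<le> t" "t \<le> 2 * t0" and x: "norm (x - x0) \<le> 1" for t x
  proof -
    have tp: "0 < t"
      using t t0 by linarith
    have "norm ((z - x) /\<^sub>R t) \<le> R0 / (t0 / 2)"
    proof -
      have "0 \<le> R0"
        by (simp add: R0_def)
      moreover have "norm (z - x) \<le> R0"
        using norm_triangle_ineq4[of z x] n0[OF x] by (simp add: R0_def)
      ultimately have "norm (z - x) / t \<le> R0 / (t0 / 2)"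
        using t t0 by (intro frac_le) auto
      moreover have "norm ((z - x) /\<^sub>R t) = norm (z - x) / t"
        using tp by (simp add: divide_inverse_commute)
      ultimately show ?thesis
        by metis
    qed
    moreover have "max (norm x) (norm z) \<le> R0"
      using n0[OF x] norm_ge_zero[of z] norm_ge_zero[of x0] unfolding R0_def max.bounded_iff
      by (intro conjI; linarith)
    ultimately have "?V t x \<le> ennreal (t * M0) + \<phi> z"
      by (intro value_function_le_straight tp M0(2)) auto
    also have "\<dots> \<le> ennreal (2 * t0 * M0) + ennreal (enn2real (\<phi> z))"
      using z t M0 by (intro add_mono ennreal_leI mult_right_mono) (auto simp: less_top)
    also have "\<dots> = ennreal (2 * t0 * M0 + enn2real (\<phi> z))"
      using M0 t0 by (intro ennreal_plus[symmetric]) auto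
    also have "\<dots> < ennreal G"
      using M0 t0 by (intro ennreal_lessI) (auto simp: G_def add_nonneg_pos)
    finally show ?thesis .
  qed
  \<comment> \<open>\<open>R\<close> covers all points met when speeding up, for durations up to
    \<open>2 * t0\<close> and cost \<open>G\<close>. \<open>U\<close> covers the speeds needed for
    durations from \<open>t0 / 2\<close> on, as well as the unit speed of a move.\<close>
  define R where "R = norm x0 + 1 + K * (2 * t0) + G"
  define U where "U = 1 + 2 * K + 4 * (G + 1) / (t0 / 2)"
  obtain M where M: "0 \<le> M" "\<And>p u. norm p \<le> R \<Longrightarrow> norm u \<le> U \<Longrightarrow> L p u \<le> M"
    using Lagrangian_bound[OF lb] by metis
  have U: "1 \<le> U" "0 \<le> U"
    using K G t0 by (auto simp: U_def)
  have R1: "norm x0 + 1 \<le> R"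
    using K G t0 by (simp add: R_def)
  \<comment> \<open>For \<open>s > t\<close> wait, for \<open>s < t\<close> speed up; the bound
    \<open>t0 / 4\<close> ensures that twice the time saved is at most \<open>t\<close>.\<close>
  have time: "?V s x \<le> ?V t x + ennreal (\<bar>s - t\<bar> * M)"
    if "t0 / 2 \<le> t" "t \<le> 2 * t0" "\<bar>s - t\<bar> \<le> t0 / 4" and x: "norm (x - x0) \<le> 1" for s t x
  proof -
    have tp: "0 < t"
      using that t0 by linarith
    consider "s = t" | "t < s" | "s < t"
      by linarith
    then show ?thesis
    proof cases
      case 2
      have "?V (t + (s - t)) x \<le> ?V t (x + (s - t) *\<^sub>R 0) + ennreal ((s - t) * M)"
        using 2 n0[OF x] R1 U tp by (intro value_function_straight Lm M(2)) auto
      with 2 show ?thesis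
        by simp
    next
      case 3
      have "?V (t - (t - s)) x \<le> ?V t x + ennreal ((t - s) * M)"
      proof (rule value_function_speed_up[OF Lm L K V G])
        fix p u :: 'a assume p: "norm (p - x) \<le> K * t + G" and u: "norm u \<le> 2 * K + 4 * (G + 1) / t"
        have "K * t \<le> K * (2 * t0)"
          using that K by (intro mult_left_mono) auto
        then have pR: "norm p \<le> R"
          using p n0[OF x] norm_triangle_ineq2[of p x] by (simp add: R_def)
        have "4 * (G + 1) / t \<le> 4 * (G + 1) / (t0 / 2)"
          using that t0 G by (intro divide_left_mono) auto
        then have "norm u \<le> U"
          using u by (simp add: U_def)
        with pR show "L p u \<le> M"
          by (rule M(2))
      qed (use 3 that in auto)
      with 3 show ?thesis
        by simp
    qed simp
  qed
  have move: "?V (s + norm (x - x')) x' \<le> ?V s x + ennreal (norm (x - x') * M)"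
    if "0 < s" and x: "norm (x - x0) \<le> 1" "norm (x' - x0) \<le> 1" for s x x'
  proof (cases "x = x'")
    case False
    define h where "h = norm (x - x')"
    define u where "u = (x - x') /\<^sub>R h"
    have h: "0 < h"
      using False by (simp add: h_def)
    have "norm u = 1"
      using h by (simp add: u_def flip: h_def)
    have xu: "x' + h *\<^sub>R u = x"
      using h by (simp add: u_def)
    have "?V (s + h) x' \<le> ?V s (x' + h *\<^sub>R u) + ennreal (h * M)"
    proof (rule value_function_straight[OF Lm \<open>0 < s\<close> h])
      fix r assume r: "0 < r" "r \<le> h"
      have "x' + r *\<^sub>R u = (1 - r / h) *\<^sub>R x' + (r / h) *\<^sub>R x"
        by (simp add: u_def algebra_simps divide_inverse)
      also have "\<dots> \<in> cball x0 1"
        using r h x by (intro convexD_alt[OF convex_cball]) (auto simp: dist_norm norm_minus_commute)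
      finally have "norm (x' + r *\<^sub>R u) \<le> norm x0 + 1"
        by (intro n0) (simp add: dist_norm norm_minus_commute)
      then show "L (x' + r *\<^sub>R u) u \<le> M"
        using R1 U \<open>norm u = 1\<close> by (intro M(2)) auto
    qed
    then show ?thesis
      by (simp add: xu flip: h_def)
  qed simp
  show ?thesis
  proof (rule that[OF M(1)])
    fix t x t' x'
    assume t: "\<bar>t - t0\<bar> < t0 / 16" "\<bar>t' - t0\<bar> < t0 / 16" and x: "norm (x - x0) \<le> 1" "norm (x' - x0) \<le> 1"
      and xx: "norm (x - x') \<le> t0 / 8"
    define h where "h = norm (x - x')"
    have h: "0 \<le> h" "h \<le> t0 / 8"
      using xx by (auto simp: h_def)
    \<comment> \<open>The remaining time \<open>t' - h\<close> is positive and differs from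
      \<open>t\<close> by at most \<open>t0 / 8 + t0 / 8\<close>, as \<open>time\<close>
      requires.\<close>
    have "?V (t' - h + h) x' \<le> ?V (t' - h) x + ennreal (h * M)"
      unfolding h_def using t xx x t0 by (intro move) (auto simp: abs_if split: if_splits)
    also have "?V (t' - h) x \<le> ?V t x + ennreal (\<bar>t' - h - t\<bar> * M)"
      using t h x t0 by (intro time) linarith+
    also have "?V t x + ennreal (\<bar>t' - h - t\<bar> * M) + ennreal (h * M) = ?V t x + ennreal (\<bar>t' - h - t\<bar> * M + h * M)"
      using M h by (simp add: add.assoc flip: ennreal_plus)
    also have "\<dots> \<le> ?V t x + ennreal (M * (\<bar>t' - t\<bar> + 2 * h))"
    proof (intro add_left_mono ennreal_leI)
      have "M * (\<bar>t' - h - t\<bar> + h) \<le> M * (\<bar>t' - t\<bar> + 2 * h)"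
        using M h by (intro mult_left_mono) linarith+
      then show "\<bar>t' - h - t\<bar> * M + h * M \<le> M * (\<bar>t' - t\<bar> + 2 * h)"
        by (simp add: algebra_simps)
    qed
    finally show "?V t' x' \<le> ?V t x + ennreal (M * (\<bar>t' - t\<bar> + 2 * norm (x - x')))"
      by (simp add: h_def)
  qed
qed

text \<open>Finiteness belongs to the conclusion because \<open>enn2real\<close> would turn infinite
  values into 0, so that the Lipschitz bound alone would not determine the value function.\<close>

theorem corollary3p4:
  fixes L :: "real ^ 'n \<Rightarrow> real ^ 'n \<Rightarrow> real"
    and \<Theta> :: "real ^ 'n \<Rightarrow> real"
    and \<phi> :: "real ^ 'n \<Rightarrow> ennreal"
  assumes L_nonneg: "\<And>x u. 0 \<le> L x u"
    and L_lsc: "lower_semicontinuous (\<lambda>(x, u). L x u)"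
    and L_convex: "\<And>x. convex_on UNIV (L x)"
    and Theta_nonneg: "\<And>u. 0 \<le> \<Theta> u"
    and Theta_convex: "convex_on UNIV \<Theta>"
    and Theta_superlinear: "filterlim (\<lambda>u. \<Theta> u / norm u) at_top at_infinity"
    and L_ge_Theta: "\<And>x u. \<Theta> u \<le> L x u"
    and phi_lsc: "lower_semicontinuous \<phi>"
    and phi_proper: "\<exists>x. \<phi> x \<noteq> \<infinity>"
    and L_locally_bounded: "locally_bounded (\<lambda>(x, u). L x u)"
  shows "(\<forall>t>0. \<forall>x. value_function L \<phi> t x < \<infinity>) \<and>
    locally_lipschitz_on ({0<..} \<times> UNIV) (\<lambda>(t, x). enn2real (value_function L \<phi> t x))"
proof (intro conjI allI impI)
  let ?V = "value_function L \<phi>"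
  obtain z where z: "\<phi> z \<noteq> \<infinity>"
    using phi_proper by blast
  show fin: "?V t x < \<infinity>" if "0 < t" for t x
    by (rule value_function_finite[where \<phi>=\<phi>, OF L_locally_bounded z that])
  have Lm: "(\<lambda>(x, u). L x u) \<in> borel_measurable borel"
    by (rule borel_measurable_lower_semicontinuous[OF L_lsc])
  obtain K where K: "0 \<le> K" "\<And>u. norm u \<le> K + \<Theta> u"
    using superlinear_imp_norm_le[OF Theta_nonneg Theta_superlinear] by blast
  have KL: "norm u \<le> K + L x u" for x u
    using K(2)[of u] L_ge_Theta[of u x] by linarith
  show "locally_lipschitz_on ({0<..} \<times> UNIV) (\<lambda>(t, x). enn2real (?V t x))"
    unfolding locally_lipschitz_on_def
  proof (intro ballI)
    fix q :: "real \<times> (real ^ 'n)" assume "q \<in> {0<..} \<times> UNIV"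
    then obtain t0 x0 where q: "q = (t0, x0)" and t0: "0 < t0"
      by auto
    obtain M where M: "0 \<le> M"
      "\<And>t x t' x'. \<bar>t - t0\<bar> < t0 / 16 \<Longrightarrow> \<bar>t' - t0\<bar> < t0 / 16 \<Longrightarrow> norm (x - x0) \<le> 1 \<Longrightarrow> norm (x' - x0) \<le> 1 \<Longrightarrow>
        norm (x - x') \<le> t0 / 8 \<Longrightarrow>
        ?V t' x' \<le> ?V t x + ennreal (M * (\<bar>t' - t\<bar> + 2 * norm (x - x')))"
      using value_function_lipschitz_near[where ?x0.0 = x0 and \<phi> = \<phi>, OF Lm L_nonneg K(1) KL L_locally_bounded z t0] by blast
    \<comment> \<open>Two points of the ball are then less than \<open>2 * e \<le> t0 / 8\<close>
      apart in space, and each lies within distance 1 of \<open>x0\<close>.\<close>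
    define e where "e = min (t0 / 16) 1"
    have near: "\<bar>t - t0\<bar> < e \<and> norm (x - x0) < e \<and> 0 < t" if "(t, x) \<in> ball q e" for t x
    proof -
      have "dist (t, x) q < e"
        using that by (simp add: dist_commute)
      then have "\<bar>t - t0\<bar> < e" "norm (x - x0) < e"
        using dist_fst_le[of "(t, x)" q] dist_snd_le[of "(t, x)" q] by (auto simp: q dist_norm)
      moreover have "e \<le> t0 / 16"
        by (simp add: e_def)
      ultimately show ?thesis
        using t0 by linarith
    qed
    have le: "enn2real (?V t' x') - enn2real (?V t x) \<le> 3 * M * dist (t, x) (t', x')"
      if tx: "(t, x) \<in> ball q e" "(t', x') \<in> ball q e" for t x t' x'
    proof -
      have e: "e \<le> t0 / 16" "e \<le> 1"
        by (auto simp: e_def)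
      note n = near[OF tx(1)] near[OF tx(2)]
      have "norm (x - x') \<le> norm (x - x0) + norm (x' - x0)"
        using norm_triangle_ineq4[of "x - x0" "x' - x0"] by simp
      then have "norm (x - x') \<le> t0 / 8"
        using n e by linarith
      then have "?V t' x' \<le> ?V t x + ennreal (M * (\<bar>t' - t\<bar> + 2 * norm (x - x')))"
        using n e by (intro M(2)) auto
      also have "\<dots> = ennreal (enn2real (?V t x) + M * (\<bar>t' - t\<bar> + 2 * norm (x - x')))"
        using fin[of t x] n M(1) by (simp add: less_top)
      finally have "enn2real (?V t' x') \<le> enn2real (?V t x) + M * (\<bar>t' - t\<bar> + 2 * norm (x - x'))"
        using M(1) by (intro enn2real_leI) auto
      moreover have "\<bar>t' - t\<bar> \<le> dist (t, x) (t', x')" "norm (x - x') \<le> dist (t, x) (t', x')"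
        using dist_fst_le[of "(t, x)" "(t', x')"] dist_snd_le[of "(t, x)" "(t', x')"]
        by (auto simp: dist_norm abs_minus_commute)
      \<comment> \<open>Each coordinate difference is at most the product distance, which gives the
        factor \<open>3 = 1 + 2\<close>.\<close>
      then have "M * (\<bar>t' - t\<bar> + 2 * norm (x - x')) \<le> M * (3 * dist (t, x) (t', x'))"
        using M(1) by (intro mult_left_mono) auto
      ultimately show ?thesis
        by simp
    qed
    show "\<exists>e>0. \<exists>C. C-lipschitz_on (ball q e \<inter> {0<..} \<times> UNIV) (\<lambda>(t, x). enn2real (?V t x))"
    proof (rule exI[of _ e], intro conjI exI[of _ "3 * M"])
      show "0 < e"
        using t0 by (simp add: e_def)
      show "(3 * M)-lipschitz_on (ball q e \<inter> {0<..} \<times> UNIV) (\<lambda>(t, x). enn2real (?V t x))"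
      proof (rule lipschitz_onI)
        fix a b assume ab: "a \<in> ball q e \<inter> {0<..} \<times> UNIV" "b \<in> ball q e \<inter> {0<..} \<times> UNIV"
        obtain t x t' x' where tx: "a = (t, x)" "b = (t', x')"
          by (metis surj_pair)
        show "dist (case a of (t, x) \<Rightarrow> enn2real (?V t x)) (case b of (t, x) \<Rightarrow> enn2real (?V t x)) \<le> 3 * M * dist a b"
          using le[of t x t' x'] le[of t' x' t x] ab
          by (auto simp: tx dist_real_def dist_commute abs_le_iff)
      qed (use M in simp)
    qed
  qed
qed

end
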